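(* For every $t\in\mathbb{N}$, every $n$-vertex weighted graph that is $K_{t,t}$-induced-minor-free has an $(\mathcal{O}_t(n^{1/2}\log n),\,4)$-coverable balanced separator.
   Context: All graphs are finite, simple and undirected. $K_{t,t}$ is the complete bipartite graph with both sides of size $t$. Weighted graph: a graph $G$ equipped with a vertex weight function $\mathbf{w}\colon V(G)\to\mathbb{R}_{\geq 0}$; for a subgraph or vertex subset $X$, $\mathbf{w}(X)$ is the total weight of the vertices in $X$. A balanced separator of $G$ is a set $S\subseteq V(G)$ such that every connected component $C$ of $G-S$ satisfies $\mathbf{w}(C)\leq \mathbf{w}(G)/2$. A set $S\subseteq V(G)$ is $(k,r)$-coverable if there is $X\subseteq V(G)$ with $|X|\leq k$ such that every vertex of $S$ is at distance (number of edges of a shortest path in $G$) at most $r$ from some vertex of $X$. $H$ is an induced minor of $G$ if there are pairwise disjoint (nonempty) connected subgraphs $\{B_u\}_{u\in V(H)}$ of $G$ such that for any two distinct $u,v\in V(H)$, $u$ and $v$ are adjacent in $H$ if and only if $B_u$ and $B_v$ are adjacent in $G$ (i.e. some edge of $G$ has one endpoint in $B_u$ and the other in $B_v$). $G$ is $H$-induced-minor-free if $H$ is not an induced minor of $G$. $\mathcal{O}_t(\cdot)$ hides a multiplicative constant that may depend only on $t$; the bound is for all $n\geq 2$. *)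

theory Defs
  imports Complex_Main "Graph_Theory.Graph_Theory"
begin

text \<open>
  Finite simple undirected graphs are the \<open>pair_graph\<close>s of the Graph_Theory library: finite,
  loop-free, symmetric digraphs whose arcs are ordered pairs of vertices.
\<close>

definition coverable :: "'a pair_pre_digraph \<Rightarrow> nat \<Rightarrow> nat \<Rightarrow> 'a set \<Rightarrow> bool" where
  "coverable G k r S \<longleftrightarrow>
     S \<subseteq> pverts G \<and>
     (\<exists>X \<subseteq> pverts G. card X \<le> k \<and>
        (\<forall>v\<in>S. \<exists>x\<in>X. wf_digraph.\<mu> (with_proj G) (\<lambda>_. 1) x v \<le> ereal (real r)))"

text \<open>
  In a symmetric digraph, the strong components \<open>sccs\<close> are the connected components; see
  \<open>sccs_eq_connected_components\<close> below.
\<close>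

definition balanced_separator ::
  "'a pair_pre_digraph \<Rightarrow> ('a \<Rightarrow> real) \<Rightarrow> 'a set \<Rightarrow> bool" where
  "balanced_separator G w S \<longleftrightarrow>
     S \<subseteq> pverts G \<and>
     (\<forall>C \<in> pre_digraph.sccs (with_proj G \<restriction> (pverts G - S)).
        sum w (verts C) \<le> sum w (pverts G) / 2)"

lemma sccs_eq_connected_components:
  assumes "sym_digraph G"
  shows "pre_digraph.sccs G =
    {C. induced_subgraph C G \<and> Digraph_Component.connected C \<and>
        \<not> (\<exists>D. induced_subgraph D G \<and> Digraph_Component.connected D \<and> verts C \<subset> verts D)}"
proof -
  interpret sym_digraph G by fact
  have "strongly_connected C \<longleftrightarrow> Digraph_Component.connected C" if "induced_subgraph C G" for C
  proof -
    interpret C: sym_digraph C using that by (rule induced_graph_imp_graph)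
    show ?thesis 
      using C.reachable_mk_symmetric_eq[OF C.sym_arcs]
      by (simp add: strongly_connected_def connected_def)
  qed
  then show ?thesis unfolding sccs_def by blast
qed

text \<open>
  The library's \<open>connected\<close> includes that the vertex set is nonempty. It is weak connectivity of
  a digraph, so the branch sets are required to be undirected graphs themselves.
\<close>

definition induced_minor :: "'b pair_pre_digraph \<Rightarrow> 'a pair_pre_digraph \<Rightarrow> bool" where
  "induced_minor H G \<longleftrightarrow>
     (\<exists>B :: 'b \<Rightarrow> 'a pair_pre_digraph.
        (\<forall>u\<in>pverts H. pair_graph (B u) \<and> subgraph (with_proj (B u)) (with_proj G) \<and>
           Digraph_Component.connected (with_proj (B u))) \<and>
        (\<forall>u\<in>pverts H. \<forall>v\<in>pverts H. u \<noteq> v \<longrightarrow>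
           pverts (B u) \<inter> pverts (B v) = {} \<and>
           ((u, v) \<in> parcs H \<longleftrightarrow>
              (\<exists>x\<in>pverts (B u). \<exists>y\<in>pverts (B v). (x, y) \<in> parcs G))))"

definition induced_minor_free :: "'b pair_pre_digraph \<Rightarrow> 'a pair_pre_digraph \<Rightarrow> bool" where
  "induced_minor_free H G \<longleftrightarrow> \<not> induced_minor H G"

definition complete_bipartite :: "nat \<Rightarrow> nat \<Rightarrow> (nat + nat) pair_pre_digraph" where
  "complete_bipartite m n =
     (let U = Inl ` {..<m}; V = Inr ` {..<n}
      in \<lparr>pverts = U \<union> V, parcs = U \<times> V \<union> V \<times> U\<rparr>)"

lemma complete_bipartite_digraph_complete_bipartite:
  "complete_bipartite_digraph m n (with_proj (complete_bipartite m n))"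
proof -
  let ?U = "Inl ` {..<m} :: (nat + nat) set" and ?V = "Inr ` {..<n} :: (nat + nat) set"
  have "card ?U = m" "card ?V = n"
    by (simp_all add: card_image)
  moreover have "?U \<inter> ?V = {}"
    by auto
  ultimately show ?thesis
    unfolding complete_bipartite_digraph_pair_def complete_bipartite_def Let_def
    by (intro conjI exI[of _ ?U] exI[of _ ?V]) simp_all
qed

end

theory Submission
  imports Defs
begin

text \<open>
  The argument follows the Plotkin--Rao--Smith separator theorem. Let \<open>l\<close> be about
  \<open>\<surd>n\<close> and assume that no suitable separator exists. One maintains an induced minor
  model of a complete bipartite graph whose branch sets have \<open>O(l log n)\<close> vertices, a set
  \<open>Z\<close> of at most \<open>n/l\<close> further vertices, and the component \<open>D\<close> of more than
  half of the weight that remains after deleting \<open>Z\<close> and the closed neighbourhoods of the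
  branch sets. A branch set can be dropped unless it has a private contact: a neighbour of
  \<open>D\<close> in its closed neighbourhood and in that of no other branch set. Run a breadth-first
  search in \<open>D\<close> from the vertices next to the private contacts of a branch set: if some
  layer is \<open>l\<close> times smaller than both sides, it is moved to \<open>Z\<close>; otherwise all of
  \<open>D\<close> is reached within \<open>O(l log n)\<close> steps. In the latter case, a small tree in
  \<open>D\<close> together with one private contact of every branch set of one side is adjacent to
  exactly the branch sets of that side, so it is a new branch set for the other side. Since
  \<open>D\<close> keeps shrinking, both sides eventually have \<open>t\<close> branch sets. Balls of radius 1
  suffice for the covering.
\<close>

section \<open>Connected sets and the graph library\<close>

definition closed_nbhd :: "('a \<times> 'a) set \<Rightarrow> 'a set \<Rightarrow> 'a set" where
  "closed_nbhd E X = X \<union> E `` X"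

text \<open>This is strong connectivity of the digraph induced on \<open>X\<close>, hence ordinary
  connectivity when \<open>E\<close> is symmetric. It is phrased as a closure principle so that
  later arguments need no walks.\<close>

definition conn :: "('a \<times> 'a) set \<Rightarrow> 'a set \<Rightarrow> bool" where
  "conn E X \<longleftrightarrow> X \<noteq> {} \<and> (\<forall>A. A \<inter> X \<noteq> {} \<longrightarrow> E `` (A \<inter> X) \<inter> X \<subseteq> A \<longrightarrow> X \<subseteq> A)"

lemma conn_nonempty: "conn E X \<Longrightarrow> X \<noteq> {}"
  unfolding conn_def by (rule conjunct1)

text \<open>Leaving \<open>D\<close> along an arc means entering \<open>S\<close>, which
  \<open>X\<close> avoids, so \<open>D \<inter> X\<close> is closed inside \<open>X\<close>. With a
  separator, a layer or a complement as \<open>S\<close>, this confines connected sets in most of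
  the later arguments.\<close>

lemma conn_subset:
  assumes "conn E X" "X \<inter> D \<noteq> {}" "E `` D \<subseteq> D \<union> S" "X \<inter> S = {}"
  shows "X \<subseteq> D"
proof -
  have "E `` (D \<inter> X) \<inter> X \<subseteq> D"
    using assms(3,4) by blast
  then show ?thesis
    using assms(1,2) unfolding conn_def by blast
qed

lemma conn_singleton: "conn E {v}"
  unfolding conn_def by auto

lemma conn_insert:
  assumes "conn E X" "u \<in> X" "(u, v) \<in> E" "(v, u) \<in> E"
  shows "conn E (insert v X)"
  unfolding conn_def
proof (intro conjI allI impI)
  fix A assume A: "A \<inter> insert v X \<noteq> {}" "E `` (A \<inter> insert v X) \<inter> insert v X \<subseteq> A"
  have "A \<inter> X \<noteq> {}"
    using A assms(2,4) by (cases "v \<in> A") blast+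
  moreover have "E `` (A \<inter> X) \<inter> X \<subseteq> A"
    using A(2) by blast
  ultimately have "X \<subseteq> A"
    using assms(1) unfolding conn_def by blast
  moreover have "v \<in> A"
    using \<open>X \<subseteq> A\<close> A(2) assms(2,3) by blast
  ultimately show "insert v X \<subseteq> A"
    by blast
qed simp

text \<open>A closed set that meets one \<open>T i\<close> swallows it, so it contains the common
  vertex \<open>v\<close> and therefore swallows all the others.\<close>

lemma conn_Union_star:
  assumes "\<And>i. i \<in> I \<Longrightarrow> conn E (T i) \<and> v \<in> T i"
  shows "conn E (insert v (\<Union>i\<in>I. T i))" (is "conn E ?X")
  unfolding conn_def
proof (intro conjI allI impI)
  fix A assume A: "A \<inter> ?X \<noteq> {}" "E `` (A \<inter> ?X) \<inter> ?X \<subseteq> A"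
  have T: "T i \<subseteq> A" if "i \<in> I" "A \<inter> T i \<noteq> {}" for i
  proof -
    have "E `` (A \<inter> T i) \<inter> T i \<subseteq> A"
      using A(2) that(1) by blast
    with assms[OF that(1)] that(2) show ?thesis
      unfolding conn_def by blast
  qed
  have "v \<in> A"
    using A(1) T assms by blast
  then show "?X \<subseteq> A"
    using T assms by blast
qed simp

section \<open>Comparison with reachability and strong components\<close>

lemma conn_reachable:
  assumes "conn (parcs G) X" "u \<in> X" "v \<in> X"
  shows "u \<rightarrow>\<^sup>*\<^bsub>with_proj \<lparr>pverts = X, parcs = parcs G \<inter> X \<times> X\<rparr>\<^esub> v"
proof -
  let ?H = "with_proj \<lparr>pverts = X, parcs = parcs G \<inter> X \<times> X\<rparr>"
  interpret wf_digraph ?H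
    by unfold_locales auto
  \<comment> \<open>The part of \<open>X\<close> reachable from \<open>u\<close> can only be left by
    leaving \<open>X\<close>, so \<open>conn_subset\<close> applies with \<open>- X\<close> as
    boundary.\<close>
  define A where "A = {x \<in> X. u \<rightarrow>\<^sup>*\<^bsub>?H\<^esub> x}"
  have "parcs G `` A \<subseteq> A \<union> - X"
  proof
    fix y assume "y \<in> parcs G `` A"
    then obtain x where x: "u \<rightarrow>\<^sup>*\<^bsub>?H\<^esub> x" "x \<in> X" "(x, y) \<in> parcs G"
      unfolding A_def by auto
    show "y \<in> A \<union> - X"
    proof (cases "y \<in> X")
      case True
      then have "(x, y) \<in> arcs_ends ?H"
        using x by simp
      with reachable_adj_trans[OF x(1)] True show ?thesis
        unfolding A_def by simp
    qed simp
  qed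
  moreover have "u \<in> A"
    using assms(2) unfolding A_def by auto
  ultimately have "X \<subseteq> A"
    using conn_subset[OF assms(1), of A "- X"] assms(2) by blast
  then have "v \<in> A"
    using assms(3) by blast
  then show ?thesis
    unfolding A_def by simp
qed

lemma reachable_imp_closed:
  assumes "u \<rightarrow>\<^sup>*\<^bsub>H\<^esub> v" "u \<in> A" "arcs_ends H `` (A \<inter> verts H) \<subseteq> A"
  shows "v \<in> A"
  using assms(1) unfolding reachable_def
proof (induction rule: rtrancl_on_induct)
  case base
  then show ?case
    using assms(2) by simp
next
  case (step v w)
  then show ?case
    using assms(3) by blast
qed

lemma strongly_connected_imp_conn:
  assumes "induced_subgraph H (with_proj G)" "strongly_connected H"
  shows "conn (parcs G) (verts H)"
  unfolding conn_def
proof (intro conjI allI impI)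
  have "tail H = fst" "head H = snd"
    using assms(1) unfolding induced_subgraph_def subgraph_def compatible_def by auto
  moreover have "arcs H = {e \<in> parcs G. fst e \<in> verts H \<and> snd e \<in> verts H}"
    using assms(1) unfolding induced_subgraph_def by simp
  ultimately have ends: "arcs_ends H = parcs G \<inter> verts H \<times> verts H"
    unfolding arcs_ends_def arc_to_ends_def by force
  fix A assume A: "A \<inter> verts H \<noteq> {}" "parcs G `` (A \<inter> verts H) \<inter> verts H \<subseteq> A"
  then obtain u where u: "u \<in> A" "u \<in> verts H"
    by blast
  show "verts H \<subseteq> A"
  proof
    fix v assume "v \<in> verts H"
    then have "u \<rightarrow>\<^sup>*\<^bsub>H\<^esub> v"
      using assms(2) u by (auto simp: strongly_connected_def)
    then show "v \<in> A"
      by (rule reachable_imp_closed) (use u A(2) ends in auto)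
  qed
qed (use assms(2) in \<open>simp add: strongly_connected_def\<close>)

text \<open>A component of more than half of the weight is extracted as a bare vertex set. Its
  neighbours lie in \<open>D \<union> S\<close> because strong components are maximal.\<close>

lemma not_balanced_separatorE:
  assumes "pair_graph G" "S \<subseteq> pverts G" "\<not> balanced_separator G w S"
  obtains D where "conn (parcs G) D" "D \<subseteq> pverts G - S" "parcs G `` D \<subseteq> D \<union> S"
    "sum w (pverts G) / 2 < sum w D"
proof -
  interpret pair_graph G by fact
  let ?G = "with_proj G \<restriction> (pverts G - S)"
  from assms obtain C where C: "C \<in> pre_digraph.sccs ?G"
      "sum w (pverts G) / 2 < sum w (verts C)"
    unfolding balanced_separator_def by (auto simp: not_le)
  let ?E = "parcs G \<inter> (pverts G - S) \<times> (pverts G - S)"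
  let ?GS = "\<lparr>pverts = pverts G - S, parcs = ?E\<rparr>"
  have G: "?G = with_proj ?GS"
    unfolding induce_subgraph_def with_proj_def by (auto simp: mem_Times_iff)
  let ?D = "verts C"
  have ind: "induced_subgraph C (with_proj ?GS)" and sc: "strongly_connected C"
    and max: "\<And>H. induced_subgraph H (with_proj ?GS) \<Longrightarrow> strongly_connected H \<Longrightarrow> \<not> ?D \<subset> verts H"
    using C(1) unfolding G pre_digraph.sccs_def by auto
  have D: "?D \<subseteq> pverts G - S"
    using ind unfolding induced_subgraph_def subgraph_def by simp
  have cE: "conn ?E ?D"
    using strongly_connected_imp_conn[OF ind sc] by simp
  \<comment> \<open>\<open>conn\<close> only looks at arcs with both ends in \<open>X\<close>, so
    restricting the arcs to the vertices outside \<open>S\<close> does not affect it.\<close>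
  have EE: "?E `` (A \<inter> X) \<inter> X = parcs G `` (A \<inter> X) \<inter> X" if "X \<subseteq> pverts G - S" for A X
    using that by blast
  have cEE: "conn ?E X \<longleftrightarrow> conn (parcs G) X" if "X \<subseteq> pverts G - S" for X
    unfolding conn_def EE[OF that] ..
  have "parcs G `` ?D \<subseteq> ?D \<union> S"
  proof
    fix v assume "v \<in> parcs G `` ?D"
    then obtain u where u: "u \<in> ?D" "(u, v) \<in> parcs G"
      by blast
    show "v \<in> ?D \<union> S"
    proof (rule ccontr)
      assume v: "v \<notin> ?D \<union> S"
      have vE: "(u, v) \<in> ?E" "(v, u) \<in> ?E"
        using u v D in_arcsD2[OF u(2)] pair_sym_arcs unfolding symmetric_def sym_def by auto
      \<comment> \<open>Adding the neighbour \<open>v\<close> keeps the component strongly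
        connected, against its maximality.\<close>
      have c: "conn ?E (insert v ?D)"
        using conn_insert[OF cE u(1) vE] .
      let ?H = "with_proj \<lparr>pverts = insert v ?D, parcs = ?E \<inter> insert v ?D \<times> insert v ?D\<rparr>"
      have "strongly_connected ?H"
        unfolding strongly_connected_def
        using conn_reachable[of ?GS "insert v ?D"] c by simp
      moreover have "induced_subgraph ?H (with_proj ?GS)"
        unfolding induced_subgraph_def subgraph_def wf_digraph_def compatible_def
        using D v vE by auto
      ultimately show False
        using max[of ?H] v by auto
    qed
  qed
  then show thesis
    using that[of ?D] D C(2) cE cEE[OF D] by blast
qed

section \<open>Covering by balls of radius 1\<close>

lemma mu_closed_nbhd_le_1:
  assumes "pair_graph G" "x \<in> pverts G" "v \<in> closed_nbhd (parcs G) {x}"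
  shows "wf_digraph.\<mu> (with_proj G) (\<lambda>_. 1) x v \<le> 1"
proof -
  interpret pair_graph G by fact
  show ?thesis
  proof (cases "v = x")
    case True
    have "\<mu> (\<lambda>_. 1) x x \<le> awalk_cost (\<lambda>_. 1) []"
      by (rule min_cost_le_walk_cost) (use assms(2) in \<open>simp add: awalk_Nil_iff\<close>)
    then show ?thesis
      using True by (simp add: order_trans)
  next
    case False
    then have "(x, v) \<in> parcs G"
      using assms(3) unfolding closed_nbhd_def by auto
    then have "awalk x [(x, v)] v"
      using in_arcsD1 in_arcsD2 by (simp add: awalk_Cons_iff awalk_Nil_iff)
    then have "\<mu> (\<lambda>_. 1) x v \<le> awalk_cost (\<lambda>_. 1) [(x, v)]"
      by (rule min_cost_le_walk_cost)
    then show ?thesis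
      by (simp add: one_ereal_def)
  qed
qed

lemma coverable_closed_nbhd:
  assumes "pair_graph G" "X \<subseteq> pverts G" "card X \<le> k" "1 \<le> r"
    "S \<subseteq> pverts G" "S \<subseteq> closed_nbhd (parcs G) X"
  shows "coverable G k r S"
proof -
  have "\<exists>x\<in>X. wf_digraph.\<mu> (with_proj G) (\<lambda>_. 1) x v \<le> ereal (real r)" if v: "v \<in> S" for v
  proof -
    obtain x where x: "x \<in> X" "v \<in> closed_nbhd (parcs G) {x}"
      using v assms(6) unfolding closed_nbhd_def by blast
    have "(1 :: ereal) \<le> ereal (real r)"
      using assms(4) by (simp add: one_ereal_def)
    with mu_closed_nbhd_le_1[OF assms(1) _ x(2)] x(1) assms(2) show ?thesis
      using order_trans by blast
  qed
  then show ?thesis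
    unfolding coverable_def using assms by blast
qed

section \<open>Connected vertex sets as branch sets\<close>

lemma conn_imp_connected_subgraph:
  assumes "pair_graph G" "X \<subseteq> pverts G" "conn (parcs G) X"
  defines "B \<equiv> \<lparr>pverts = X, parcs = parcs G \<inter> X \<times> X\<rparr>"
  shows "pair_graph B" "subgraph (with_proj B) (with_proj G)"
    "Digraph_Component.connected (with_proj B)"
proof -
  interpret G: pair_graph G by fact
  have "finite X"
    using assms(2) G.pair_finite_verts finite_subset by blast
  then show B: "pair_graph B"
    unfolding B_def using G.pair_sym_arcs G.pair_no_loops
    by unfold_locales (auto simp: symmetric_def sym_def)
  interpret B: pair_graph B by fact
  show "subgraph (with_proj B) (with_proj G)"
    unfolding subgraph_def
    using assms(2) G.wf_digraph_axioms B.wf_digraph_axioms by (auto simp: B_def)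
  have "strongly_connected (with_proj B)"
    unfolding strongly_connected_def
    using assms(3) conn_reachable[OF assms(3)] by (simp add: B_def conn_def)
  then show "Digraph_Component.connected (with_proj B)"
    using B.reachable_mk_symmetric_eq[OF B.sym_arcs]
    by (simp add: strongly_connected_def connected_def)
qed

text \<open>Disjointness and adjacency of branch sets depend only on their vertices, so each branch
  graph can be taken to be the subgraph induced on \<open>B u\<close>.\<close>

lemma induced_minorI:
  assumes "pair_graph G"
    and "\<And>u. u \<in> pverts H \<Longrightarrow> B u \<subseteq> pverts G \<and> conn (parcs G) (B u)"
    and "\<And>u v. u \<in> pverts H \<Longrightarrow> v \<in> pverts H \<Longrightarrow> u \<noteq> v \<Longrightarrow> B u \<inter> B v = {}"
    and "\<And>u v. u \<in> pverts H \<Longrightarrow> v \<in> pverts H \<Longrightarrow> u \<noteq> v \<Longrightarrow>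
      (u, v) \<in> parcs H \<longleftrightarrow> parcs G `` B u \<inter> B v \<noteq> {}"
  shows "induced_minor H G"
  unfolding induced_minor_def
proof (intro exI[of _ "\<lambda>u. \<lparr>pverts = B u, parcs = parcs G \<inter> B u \<times> B u\<rparr>"] conjI ballI impI)
  fix u v assume uv: "u \<in> pverts H" "v \<in> pverts H" "u \<noteq> v"
  show "(u, v) \<in> parcs H \<longleftrightarrow> (\<exists>x\<in>pverts \<lparr>pverts = B u, parcs = parcs G \<inter> B u \<times> B u\<rparr>.
      \<exists>y\<in>pverts \<lparr>pverts = B v, parcs = parcs G \<inter> B v \<times> B v\<rparr>. (x, y) \<in> parcs G)"
    unfolding assms(4)[OF uv] by auto
next
  fix u assume "u \<in> pverts H"
  with assms(2) have B: "B u \<subseteq> pverts G" "conn (parcs G) (B u)"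
    by auto
  show "pair_graph \<lparr>pverts = B u, parcs = parcs G \<inter> B u \<times> B u\<rparr>"
    "subgraph (with_proj \<lparr>pverts = B u, parcs = parcs G \<inter> B u \<times> B u\<rparr>) (with_proj G)"
    "Digraph_Component.connected (with_proj \<lparr>pverts = B u, parcs = parcs G \<inter> B u \<times> B u\<rparr>)"
    by (rule conn_imp_connected_subgraph[OF assms(1) B])+
qed (use assms(3) in simp)

section \<open>Sparse layers of breadth-first search\<close>

primrec bfs_ball :: "('a \<times> 'a) set \<Rightarrow> 'a set \<Rightarrow> 'a set \<Rightarrow> nat \<Rightarrow> 'a set" where
  "bfs_ball E D C 0 = C"
| "bfs_ball E D C (Suc k) = bfs_ball E D C k \<union> E `` bfs_ball E D C k \<inter> D"

lemma bfs_ball_subset: "C \<subseteq> D \<Longrightarrow> bfs_ball E D C k \<subseteq> D"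
  by (induction k) auto

lemma bfs_ball_mono: "j \<le> k \<Longrightarrow> bfs_ball E D C j \<subseteq> bfs_ball E D C k"
  by (rule lift_Suc_mono_le[of "bfs_ball E D C"]) auto

text \<open>Tracing \<open>v\<close> back to \<open>C\<close> adds at most one vertex per search
  step. The set \<open>T\<close> obtained is the vertex set of a path.\<close>

lemma bfs_ball_tree:
  assumes "sym E" "C \<subseteq> D" "v \<in> bfs_ball E D C k"
  shows "\<exists>T. conn E T \<and> v \<in> T \<and> T \<subseteq> D \<and> T \<inter> C \<noteq> {} \<and> finite T \<and> card T \<le> Suc k"
  using assms(3)
proof (induction k arbitrary: v)
  case 0
  then show ?case
    using assms(2) conn_singleton[of E v] by (intro exI[of _ "{v}"]) auto
next
  case (Suc k)
  show ?case
  proof (cases "v \<in> bfs_ball E D C k")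
    case True
    then show ?thesis
      using Suc.IH[of v] by (meson le_Suc_eq)
  next
    case False
    with Suc.prems obtain u where u: "u \<in> bfs_ball E D C k" "(u, v) \<in> E" "v \<in> D"
      by auto
    from Suc.IH[OF u(1)] obtain T where T: "conn E T" "u \<in> T" "T \<subseteq> D" "T \<inter> C \<noteq> {}"
      "finite T" "card T \<le> Suc k"
      by blast
    have "conn E (insert v T)"
      using conn_insert[OF T(1,2) u(2)] assms(1) u(2) by (simp add: symD)
    moreover have "card (insert v T) \<le> Suc (Suc k)"
      using card_insert_le_m1[of "Suc (Suc k)" T v] T(6) by simp
    ultimately show ?thesis
      using T u(3) by (intro exI[of _ "insert v T"]) auto
  qed
qed

text \<open>Bernoulli's inequality gives \<open>(1 + 1 / l) ^ l\<close> \<ge> 2; multiplying by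
  \<open>l ^ l\<close> clears the denominator. Thus \<open>l\<close> growth steps by the factor
  \<open>1 + 1 / l\<close> at least double a quantity.\<close>

lemma two_mult_power_le_Suc_power:
  fixes l :: nat
  assumes "0 < l"
  shows "2 * l ^ l \<le> (l + 1) ^ l"
proof -
  have "2 \<le> (1 + 1 / real l) ^ l"
    using Bernoulli_inequality[OF order_trans[of "- 1" 0 "1 / real l"], of l] assms by simp
  then have "2 * real l ^ l \<le> ((1 + 1 / real l) * real l) ^ l"
    unfolding power_mult_distrib by (intro mult_right_mono) auto
  also have "(1 + 1 / real l) * real l = real l + 1"
    using assms by (simp add: field_simps)
  finally have "real (2 * l ^ l) \<le> real ((l + 1) ^ l)"
    by (simp add: add.commute)
  then show ?thesis
    by linarith
qed

text \<open>
  While no layer is sparse, the ratio between the sizes of the ball and of its complement in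
  \<open>D\<close> grows by a factor of at least \<open>1 + 1/l\<close> in every step; it starts above
  \<open>1/|D|\<close> and stays below \<open>|D|\<close>.
\<close>

lemma bfs_sparse_layer:
  assumes "finite D" "conn E D" "C \<subseteq> D" "C \<noteq> {}" "0 < l" "card D * card D < 2 ^ m"
    and "bfs_ball E D C (l * m) \<noteq> D"
  obtains k where "bfs_ball E D C (Suc k) - bfs_ball E D C k \<noteq> {}"
    "l * card (bfs_ball E D C (Suc k) - bfs_ball E D C k) \<le> card (bfs_ball E D C k)"
    "l * card (bfs_ball E D C (Suc k) - bfs_ball E D C k) \<le> card (D - bfs_ball E D C (Suc k))"
proof -
  let ?B = "bfs_ball E D C"
  define a b c where "a k = card (?B k)" and "b k = card (D - ?B k)"
    and "c k = card (?B (Suc k) - ?B k)" for k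
  have sub: "?B k \<subseteq> D" for k
    by (rule bfs_ball_subset[OF assms(3)])
  have fin: "finite (?B k)" for k
    using sub assms(1) finite_subset by blast
  have a: "a (Suc k) = a k + c k" for k
    unfolding a_def c_def using fin
    by (metis bfs_ball_mono card_Un_disjoint Diff_disjoint Un_Diff_cancel Un_absorb1 finite_Diff le_Suc_eq order_refl)
  have b: "b k = b (Suc k) + c k" for k
  proof -
    have "D - ?B k = (D - ?B (Suc k)) \<union> (?B (Suc k) - ?B k)"
      using sub[of "Suc k"] by auto
    moreover have "(D - ?B (Suc k)) \<inter> (?B (Suc k) - ?B k) = {}"
      by blast
    ultimately show ?thesis
      unfolding b_def c_def using fin assms(1) by (metis card_Un_disjoint finite_Diff)
  qed
  have a_pos: "0 < a k" for k
    unfolding a_def using fin[of k] bfs_ball_mono[of 0 k E D C] assms(4)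
    by (auto simp: card_gt_0_iff)
  have proper: "?B k \<noteq> D" if "k \<le> l * m" for k
    using bfs_ball_mono[OF that, of E D C] sub[of "l * m"] assms(7) by blast
  have b_pos: "0 < b k" if "k \<le> l * m" for k
    unfolding b_def using proper[OF that] sub[of k] assms(1) by (auto simp: card_gt_0_iff)
  \<comment> \<open>An empty layer would make the ball closed in the connected set \<open>D\<close>,
    hence equal to \<open>D\<close>.\<close>
  have layer: "?B (Suc k) - ?B k \<noteq> {}" if "k \<le> l * m" for k
  proof
    assume "?B (Suc k) - ?B k = {}"
    then have "E `` ?B k \<subseteq> ?B k \<union> - D"
      by auto
    moreover have "D \<inter> ?B k \<noteq> {}"
      using a_pos[of k] sub[of k] unfolding a_def by (metis card.empty inf.absorb2 less_irrefl)
    ultimately have "D \<subseteq> ?B k"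
      using conn_subset[OF assms(2), of "?B k" "- D"] by blast
    then show False
      using proper[OF that] sub[of k] by blast
  qed
  show thesis
  proof (cases "\<exists>k \<le> l * m. l * c k \<le> a k \<and> l * c k \<le> b (Suc k)")
    case True
    then show thesis
      using that layer unfolding a_def b_def c_def by blast
  next
    case False
    \<comment> \<open>This is the growth of the ratio \<open>a k / b k\<close> by the factor
      \<open>1 + 1 / l\<close>, multiplied out because \<open>b (Suc k)\<close> may be 0. A layer
      that is not sparse has \<open>a k\<close> or \<open>b (Suc k)\<close> at most
      \<open>l * c k\<close>, and this bounds \<open>a k * b (Suc k)\<close> by \<open>l\<close>
      times the mixed terms of \<open>a (Suc k) * b k\<close>.\<close>
    have step: "(l + 1) * (a k * b (Suc k)) \<le> l * (a (Suc k) * b k)" if "k \<le> l * m" for k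
    proof -
      have "a k \<le> l * c k \<or> b (Suc k) \<le> l * c k"
        using False that by (meson nat_le_linear)
      then have "a k * b (Suc k) \<le> l * c k * b (Suc k) \<or> a k * b (Suc k) \<le> a k * (l * c k)"
        by auto
      then have "a k * b (Suc k) \<le> l * c k * b (Suc k) + a k * (l * c k)"
        by linarith
      also have "\<dots> \<le> l * (c k * b (Suc k) + a k * c k + c k * c k)"
        by (simp add: algebra_simps)
      finally show ?thesis
        unfolding a[of k] b[of k] by (simp add: algebra_simps)
    qed
    have "(l + 1) ^ k * (a 0 * b k) \<le> l ^ k * (a k * b 0)" if "k \<le> l * m" for k
      using that
    proof (induction k)
      case (Suc k)
      then have "((l + 1) * (a k * b (Suc k))) * ((l + 1) ^ k * (a 0 * b k))
          \<le> (l * (a (Suc k) * b k)) * (l ^ k * (a k * b 0))"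
        by (intro mult_le_mono step Suc.IH) auto
      then have "(a k * b k) * ((l + 1) ^ Suc k * (a 0 * b (Suc k)))
          \<le> (a k * b k) * (l ^ Suc k * (a (Suc k) * b 0))"
        by (simp only: power_Suc mult_ac)
      moreover have "0 < a k * b k"
        using a_pos b_pos Suc.prems by simp
      ultimately show ?case
        by (simp only: mult_le_cancel1)
    qed simp
    from this[of "l * m"] have "(l + 1) ^ (l * m) * (a 0 * b (l * m)) \<le> l ^ (l * m) * (a (l * m) * b 0)"
      by simp
    moreover have "(l + 1) ^ (l * m) * 1 \<le> (l + 1) ^ (l * m) * (a 0 * b (l * m))"
      using a_pos[of 0] b_pos[of "l * m"] by (intro mult_le_mono) (auto simp: Suc_le_eq)
    \<comment> \<open>The \<open>l * m\<close> steps form \<open>m\<close> blocks of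
      \<open>l\<close> steps, and each block doubles the ratio.\<close>
    moreover have "l ^ (l * m) * 2 ^ m \<le> (l + 1) ^ (l * m)"
      using power_mono[OF two_mult_power_le_Suc_power[OF assms(5)], of m]
      by (simp add: power_mult power_mult_distrib mult.commute)
    ultimately have "l ^ (l * m) * 2 ^ m \<le> l ^ (l * m) * (a (l * m) * b 0)"
      by linarith
    then have "2 ^ m \<le> a (l * m) * b 0"
      using assms(5) by simp
    also have "\<dots> \<le> card D * card D"
      unfolding a_def b_def using sub assms(1) by (intro mult_le_mono card_mono) auto
    finally show thesis
      using assms(6) by simp
  qed
qed

section \<open>Growing a biclique model\<close>

lemma closed_nbhd_Un: "closed_nbhd E (X \<union> Y) = closed_nbhd E X \<union> closed_nbhd E Y"
  unfolding closed_nbhd_def by blast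

lemma closed_nbhd_superset: "X \<subseteq> closed_nbhd E X"
  unfolding closed_nbhd_def by blast

locale weighted_sym_graph =
  fixes V :: "'a set" and E :: "('a \<times> 'a) set" and w :: "'a \<Rightarrow> real"
  assumes finite_V: "finite V" and E_subset: "E \<subseteq> V \<times> V" and sym_E: "sym E"
    and w_nonneg: "v \<in> V \<Longrightarrow> 0 \<le> w v"
begin

definition heavy :: "'a set \<Rightarrow> bool" where
  "heavy D \<longleftrightarrow> D \<subseteq> V \<and> conn E D \<and> sum w V / 2 < sum w D"

text \<open>A heavy \<open>D\<close> that avoids \<open>S\<close> and has all its neighbours in
  \<open>D \<union> S\<close> is a component of the graph minus \<open>S\<close>, so the last
  conjunct says that \<open>S\<close> is balanced. Covering is by closed neighbourhoods, that is,
  with radius 1.\<close>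

definition coverable_separator :: "nat \<Rightarrow> 'a set \<Rightarrow> bool" where
  "coverable_separator k S \<longleftrightarrow> S \<subseteq> V \<and> (\<exists>X \<subseteq> V. card X \<le> k \<and> S \<subseteq> closed_nbhd E X) \<and>
     \<not> (\<exists>D. heavy D \<and> D \<inter> S = {} \<and> E `` D \<subseteq> D \<union> S)"

definition anticomplete :: "'a set set \<Rightarrow> bool" where
  "anticomplete P \<longleftrightarrow> (\<forall>X\<in>P. \<forall>Y\<in>P. X \<noteq> Y \<longrightarrow> X \<inter> closed_nbhd E Y = {})"

text \<open>An induced minor model of a complete bipartite graph with at most \<open>t\<close>
  branch sets on each side. Plain sets of branch sets can replace indexed families because branch
  sets are nonempty and pairwise disjoint.\<close>

definition biclique_model :: "nat \<Rightarrow> nat \<Rightarrow> 'a set set \<Rightarrow> 'a set set \<Rightarrow> bool" where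
  "biclique_model s t P Q \<longleftrightarrow> finite P \<and> finite Q \<and> card P \<le> t \<and> card Q \<le> t \<and>
     (\<forall>X \<in> P \<union> Q. X \<subseteq> V \<and> conn E X \<and> card X \<le> s) \<and> anticomplete P \<and> anticomplete Q \<and>
     (\<forall>X\<in>P. \<forall>Y\<in>Q. X \<inter> Y = {} \<and> E `` X \<inter> Y \<noteq> {})"

definition blocked :: "'a set \<Rightarrow> 'a set set \<Rightarrow> 'a set" where
  "blocked Z M = Z \<union> closed_nbhd E (\<Union>M)"

text \<open>
  The last conjunct of \<open>state\<close> is the charging scheme: whenever a layer enters \<open>Z\<close>, at
  least \<open>l\<close> times as many vertices leave \<open>D\<close> for good.
\<close>

definition state :: "nat \<Rightarrow> nat \<Rightarrow> nat \<Rightarrow> 'a set \<Rightarrow> 'a set \<Rightarrow> 'a set set \<Rightarrow> 'a set set \<Rightarrow> bool" where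
  "state l s t D Z P Q \<longleftrightarrow> biclique_model s t P Q \<and> Z \<subseteq> V \<and> heavy D \<and>
     D \<inter> blocked Z (P \<union> Q) = {} \<and> E `` D \<subseteq> D \<union> blocked Z (P \<union> Q) \<and>
     l * card Z + card D \<le> card V"

section \<open>Symmetry and heavy sets\<close>

lemma E_symD: "(u, v) \<in> E \<Longrightarrow> (v, u) \<in> E"
  using sym_E by (rule symD)

lemma closed_nbhd_subset: "X \<subseteq> V \<Longrightarrow> closed_nbhd E X \<subseteq> V"
  unfolding closed_nbhd_def using E_subset by blast

lemma closed_nbhd_commute: "X \<inter> closed_nbhd E Y = {} \<longleftrightarrow> Y \<inter> closed_nbhd E X = {}"
  unfolding closed_nbhd_def using E_symD by blast

lemma biclique_model_commute: "biclique_model s t P Q \<longleftrightarrow> biclique_model s t Q P"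
proof -
  have "X \<inter> Y = {} \<and> E `` X \<inter> Y \<noteq> {} \<longleftrightarrow> Y \<inter> X = {} \<and> E `` Y \<inter> X \<noteq> {}" for X Y
    using E_symD by blast
  then have "(\<forall>X\<in>P. \<forall>Y\<in>Q. X \<inter> Y = {} \<and> E `` X \<inter> Y \<noteq> {}) \<longleftrightarrow>
      (\<forall>Y\<in>Q. \<forall>X\<in>P. Y \<inter> X = {} \<and> E `` Y \<inter> X \<noteq> {})"
    by metis
  then show ?thesis
    unfolding biclique_model_def Un_commute[of Q P] by argo
qed

text \<open>Interchanging the sides makes it enough to fill up \<open>P\<close>.\<close>

lemma state_commute: "state l s t D Z P Q \<longleftrightarrow> state l s t D Z Q P"
  unfolding state_def biclique_model_commute[of s t P Q] by (simp add: Un_commute)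

text \<open>Two disjoint sets of more than half of the weight each would together outweigh
  \<open>V\<close>, as weights are nonnegative.\<close>

lemma heavy_Int:
  assumes "heavy D" "heavy D'"
  shows "D \<inter> D' \<noteq> {}"
proof
  assume "D \<inter> D' = {}"
  then have "sum w (D \<union> D') = sum w D + sum w D'"
    using assms finite_V unfolding heavy_def by (intro sum.union_disjoint) (auto intro: finite_subset)
  moreover have "sum w (D \<union> D') \<le> sum w V"
    using assms finite_V w_nonneg unfolding heavy_def by (intro sum_mono2) auto
  ultimately show False
    using assms unfolding heavy_def by simp
qed

text \<open>Heavy sets meet, and a connected set avoiding \<open>S\<close> cannot leave
  \<open>D\<close>. This is why the heavy component can only shrink when more vertices are
  blocked.\<close>

lemma heavy_avoiding_subset:
  assumes "heavy D" "heavy D'" "E `` D \<subseteq> D \<union> S" "D' \<inter> S = {}"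
  shows "D' \<subseteq> D"
  using conn_subset[of E D' D S] heavy_Int[OF assms(1,2)] assms(2-4) unfolding heavy_def by blast

text \<open>Otherwise \<open>blocked Z (P \<union> Q)\<close> would be a coverable separator. Its
  centres are the vertices of \<open>Z\<close>, at most \<open>card V div l\<close> many, and those
  of the at most \<open>2 * t\<close> branch sets of at most \<open>s\<close> vertices each.\<close>

lemma exists_heavy_avoiding_blocked:
  assumes nosep: "\<nexists>S. coverable_separator k S"
    and "0 < l" "card V div l + 2 * t * s \<le> k"
    and model: "biclique_model s t P Q" and "Z \<subseteq> V" "l * card Z \<le> card V"
  obtains D where "heavy D" "D \<inter> blocked Z (P \<union> Q) = {}" "E `` D \<subseteq> D \<union> blocked Z (P \<union> Q)"
proof -
  let ?X = "Z \<union> \<Union>(P \<union> Q)"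
  have M: "\<And>X. X \<in> P \<union> Q \<Longrightarrow> X \<subseteq> V \<and> card X \<le> s" "finite (P \<union> Q)" "card (P \<union> Q) \<le> 2 * t"
    using model card_Un_le[of P Q] unfolding biclique_model_def by auto
  have "card (\<Union>(P \<union> Q)) \<le> card (P \<union> Q) * s"
    using card_UN_le[OF M(2), of "\<lambda>X. X"] sum_bounded_above[of "P \<union> Q" card s] M(1) by fastforce
  also have "\<dots> \<le> 2 * t * s"
    using M(3) by simp
  finally have "card (\<Union>(P \<union> Q)) \<le> 2 * t * s" .
  moreover have "card Z \<le> card V div l"
    using assms(2,6) by (simp add: less_eq_div_iff_mult_less_eq mult.commute)
  ultimately have "card ?X \<le> k"
    using card_Un_le[of Z "\<Union>(P \<union> Q)"] assms(3) by linarith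
  moreover have "?X \<subseteq> V"
    using M(1) assms(5) by blast
  moreover have "blocked Z (P \<union> Q) \<subseteq> closed_nbhd E ?X"
    unfolding blocked_def closed_nbhd_def by blast
  moreover have "blocked Z (P \<union> Q) \<subseteq> V"
    unfolding blocked_def using closed_nbhd_subset[of "\<Union>(P \<union> Q)"] M(1) assms(5) by blast
  ultimately show thesis
    using nosep that unfolding coverable_separator_def by blast
qed

text \<open>If every neighbour of \<open>D\<close> in the closed neighbourhood of \<open>X\<close>
  were also in that of another branch set, dropping \<open>X\<close> would leave a state with the
  same \<open>D\<close> and a smaller measure.\<close>

lemma private_contact:
  assumes st: "state l s t D Z P Q" and X: "X \<in> P \<union> Q"
    and min: "\<And>D' Z' P' Q'. state l s t D' Z' P' Q' \<Longrightarrow>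
      card D * (2 * t + 1) + card P + card Q \<le> card D' * (2 * t + 1) + card P' + card Q'"
  obtains d x where "d \<in> D" "(d, x) \<in> E" "x \<in> closed_nbhd E X"
    "\<forall>Y \<in> P \<union> Q. Y \<noteq> X \<longrightarrow> x \<notin> closed_nbhd E Y"
proof (rule ccontr)
  assume "\<not> thesis"
  with that have no: "\<And>d x. d \<in> D \<Longrightarrow> (d, x) \<in> E \<Longrightarrow> x \<in> closed_nbhd E X \<Longrightarrow>
      \<exists>Y \<in> P \<union> Q. Y \<noteq> X \<and> x \<in> closed_nbhd E Y"
    by blast
  \<comment> \<open>Removing \<open>X\<close> from both sides treats the cases
    \<open>X \<in> P\<close> and \<open>X \<in> Q\<close> at once.\<close>
  let ?P = "P - {X}" and ?Q = "Q - {X}"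
  have fin: "finite P" "finite Q"
    using st unfolding state_def biclique_model_def by auto
  have "card ?P \<le> card P" "card ?Q \<le> card Q"
    using fin by (auto intro: card_mono)
  moreover have "card ?P < card P \<or> card ?Q < card Q"
    using X fin by (auto intro: psubset_card_mono)
  ultimately have less: "card ?P + card ?Q < card P + card Q" and "card ?P \<le> t" "card ?Q \<le> t"
    using st unfolding state_def biclique_model_def by auto
  then have "biclique_model s t ?P ?Q"
    using st unfolding state_def biclique_model_def anticomplete_def by auto
  moreover have "D \<inter> blocked Z (?P \<union> ?Q) = {}"
    using st unfolding state_def blocked_def closed_nbhd_def by blast
  moreover have "E `` D \<subseteq> D \<union> blocked Z (?P \<union> ?Q)"
  proof
    fix x assume "x \<in> E `` D"
    then obtain d where d: "d \<in> D" "(d, x) \<in> E"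
      by blast
    then have "x \<in> D \<union> blocked Z (P \<union> Q)"
      using st unfolding state_def by blast
    then consider "x \<in> D \<union> Z" | Y where "Y \<in> P \<union> Q" "x \<in> closed_nbhd E Y"
      unfolding blocked_def closed_nbhd_def by blast
    then show "x \<in> D \<union> blocked Z (?P \<union> ?Q)"
    proof cases
      case 2
      then obtain Y where "Y \<in> ?P \<union> ?Q" "x \<in> closed_nbhd E Y"
        using no[OF d] by (cases "Y = X") auto
      then show ?thesis
        unfolding blocked_def closed_nbhd_def by blast
    qed (auto simp: blocked_def)
  qed
  ultimately have "state l s t D Z ?P ?Q"
    using st unfolding state_def by blast
  from min[OF this] less show False
    by simp
qed

text \<open>Here \<open>A\<close> and \<open>A'\<close> play the role of consecutive search balls.
  Once the layer \<open>A' - A\<close> is in \<open>Z\<close>, the new heavy set lies on one side of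
  it; the lost side has at least \<open>l\<close> times as many vertices as the layer and pays for
  its entry into \<open>Z\<close>.\<close>

lemma split_off_layer:
  assumes nosep: "\<nexists>S. coverable_separator k S"
    and "0 < l" "card V div l + 2 * t * s \<le> k"
    and st: "state l s t D Z P Q"
    and A: "A \<subseteq> A'" "A' \<subseteq> D" "A' - A \<noteq> {}" "E `` A \<inter> D \<subseteq> A'"
    and sparse: "l * card (A' - A) \<le> card A" "l * card (A' - A) \<le> card (D - A')"
  shows "\<exists>D'. state l s t D' (Z \<union> (A' - A)) P Q \<and> card D' < card D"
proof -
  let ?Z = "Z \<union> (A' - A)"
  have model: "biclique_model s t P Q" and Z: "Z \<subseteq> V" and hD: "heavy D"
    and ED: "E `` D \<subseteq> D \<union> blocked Z (P \<union> Q)" and cZ: "l * card Z + card D \<le> card V"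
    using st unfolding state_def by auto
  have DV: "D \<subseteq> V" and finD: "finite D"
    using hD finite_V unfolding heavy_def by (auto intro: finite_subset)
  have finA: "finite A" "finite A'"
    using finite_subset[OF _ finD] A by blast+
  have cD: "card D = card A + card (A' - A) + card (D - A')"
    using card_Diff_subset[OF finA(1) A(1)] card_mono[OF finA(2) A(1)]
      card_Diff_subset[OF finA(2) A(2)] card_mono[OF finD A(2)] by linarith
  have lZ: "l * card ?Z \<le> l * card Z + l * card (A' - A)"
    using card_Un_le[of Z "A' - A"] by (simp flip: distrib_left)
  obtain D' where D': "heavy D'" "D' \<inter> blocked ?Z (P \<union> Q) = {}" "E `` D' \<subseteq> D' \<union> blocked ?Z (P \<union> Q)"
    by (rule exists_heavy_avoiding_blocked[OF nosep assms(2,3) model, of ?Z])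
      (use Z DV A(2) lZ cZ cD sparse(1) in auto)
  have "D' \<inter> blocked Z (P \<union> Q) = {}" and avoid: "D' \<inter> (A' - A) = {}"
    using D'(2) unfolding blocked_def by auto
  then have sub: "D' \<subseteq> D"
    using heavy_avoiding_subset[OF hD D'(1) ED] by blast
  have "D' \<subset> D"
    using sub avoid A(2,3) by blast
  then have less: "card D' < card D"
    using finD by (simp add: psubset_card_mono)
  \<comment> \<open>Arcs from \<open>A\<close> that stay in \<open>D\<close> end in \<open>A\<close>
    or in the layer, so the connected \<open>D'\<close> cannot have vertices on both sides.\<close>
  have "D' \<subseteq> A \<or> D' \<subseteq> D - A'"
  proof (cases "D' \<inter> A = {}")
    case False
    moreover have "E `` A \<subseteq> A \<union> ((A' - A) \<union> - D)"
      using A(4) by blast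
    moreover have "D' \<inter> ((A' - A) \<union> - D) = {}"
      using avoid sub by blast
    ultimately show ?thesis
      using conn_subset[of E D' A] D'(1) unfolding heavy_def by blast
  qed (use sub avoid in blast)
  then have "card D' \<le> card A \<or> card D' \<le> card (D - A')"
    using finA finD by (auto intro: card_mono)
  then have "l * card ?Z + card D' \<le> card V"
    using lZ cZ cD sparse by linarith
  then have "state l s t D' ?Z P Q"
    unfolding state_def using model D' Z DV A(2) by auto
  with less show ?thesis
    by blast
qed

text \<open>
  As \<open>D\<close> avoids all closed neighbourhoods and the \<open>x X\<close> are private, the new branch set
  meets or touches no old one except through the edges from \<open>x X\<close> to \<open>X\<close>.
\<close>

lemma add_branch_set:
  assumes nosep: "\<nexists>S. coverable_separator k S"
    and "0 < l" "card V div l + 2 * t * s \<le> k"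
    and st: "state l s t D Z P Q" and "card P < t" and "v \<in> D" and s: "t * (r + 2) + 1 \<le> s"
    and T: "\<And>X. X \<in> Q \<Longrightarrow> conn E (T X) \<and> v \<in> T X \<and> T X \<subseteq> D \<and> card (T X) \<le> r + 1"
    and x: "\<And>X. X \<in> Q \<Longrightarrow> x X \<in> closed_nbhd E X \<and> (\<exists>d \<in> T X. (d, x X) \<in> E) \<and>
      (\<forall>Y \<in> P \<union> Q. Y \<noteq> X \<longrightarrow> x X \<notin> closed_nbhd E Y)"
  shows "\<exists>D' P'. state l s t D' Z P' Q \<and> card D' < card D"
proof -
  have model: "biclique_model s t P Q" and Z: "Z \<subseteq> V" and hD: "heavy D"
    and Dblocked: "D \<inter> blocked Z (P \<union> Q) = {}"
    and ED: "E `` D \<subseteq> D \<union> blocked Z (P \<union> Q)" and cZ: "l * card Z + card D \<le> card V"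
    using st unfolding state_def by auto
  have DV: "D \<subseteq> V" and finD: "finite D"
    using hD finite_V unfolding heavy_def by (auto intro: finite_subset)
  have fin: "finite P" "finite Q" "card Q \<le> t"
    using model unfolding biclique_model_def by auto
  have Davoid: "D \<inter> closed_nbhd E X = {}" if "X \<in> P \<union> Q" for X
    using Dblocked that unfolding blocked_def closed_nbhd_def by blast
  \<comment> \<open>A set in both sides would be disjoint from itself, hence empty. The privacy of
    \<open>x X\<close> for \<open>X \<in> Q\<close> thus applies to every set in
    \<open>P\<close>.\<close>
  have PQ: "X \<noteq> Y" if "X \<in> P" "Y \<in> Q" for X Y
    using that model unfolding biclique_model_def conn_def by blast
  \<comment> \<open>The explicit \<open>v\<close> keeps \<open>B\<close> nonempty when
    \<open>Q\<close> is empty, and accounts for the \<open>+ 1\<close> in the bound on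
    \<open>s\<close>; each tree with its contact contributes at most \<open>r + 2\<close>
    vertices.\<close>
  define B where "B = insert v (\<Union>X\<in>Q. insert (x X) (T X))"
  have B_cases: "y \<in> D \<or> (\<exists>X\<in>Q. y = x X)" if "y \<in> B" for y
    using that T assms(6) unfolding B_def by blast
  have x_V: "x X \<in> V" if "X \<in> Q" for X
    using x[OF that] E_subset by blast
  have "B \<subseteq> V"
    using B_cases DV x_V by blast
  have "conn E B"
    unfolding B_def
  proof (rule conn_Union_star)
    fix X assume X: "X \<in> Q"
    then obtain d where "d \<in> T X" "(d, x X) \<in> E"
      using x by blast
    then show "conn E (insert (x X) (T X)) \<and> v \<in> insert (x X) (T X)"
      using conn_insert[of E "T X" d "x X"] T[OF X] E_symD by blast
  qed
  have "card (insert (x X) (T X)) \<le> r + 2" if "X \<in> Q" for X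
    using card_insert_le_m1[of "r + 2" "T X" "x X"] T[OF that] by simp
  then have "card (\<Union>X\<in>Q. insert (x X) (T X)) \<le> card Q * (r + 2)"
    using card_UN_le[OF fin(2), of "\<lambda>X. insert (x X) (T X)"]
      sum_bounded_above[of Q "\<lambda>X. card (insert (x X) (T X))" "r + 2"] by fastforce
  also have "\<dots> \<le> t * (r + 2)"
    using fin(3) by (rule mult_le_mono1)
  finally have "card B \<le> s"
    unfolding B_def using s card_insert_le_m1[of s _ v] by simp
  have B_P: "B \<inter> closed_nbhd E Y = {}" if Y: "Y \<in> P" for Y
  proof -
    have "y \<notin> closed_nbhd E Y" if "y \<in> B" for y
      using B_cases[OF that]
    proof
      assume "y \<in> D"
      then show ?thesis
        using Davoid[of Y] Y by blast
    next
      assume "\<exists>X\<in>Q. y = x X"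
      then show ?thesis
        using x PQ[OF Y] Y by blast
    qed
    then show ?thesis
      by blast
  qed
  have B_Q: "B \<inter> Y = {} \<and> E `` B \<inter> Y \<noteq> {}" if Y: "Y \<in> Q" for Y
  proof -
    have xY: "x Y \<in> closed_nbhd E Y"
      using x[OF Y] by blast
    obtain d where d: "d \<in> D" "(d, x Y) \<in> E"
      using x[OF Y] T[OF Y] by blast
    have "d \<notin> closed_nbhd E Y"
      using Davoid[of Y] Y d(1) by blast
    \<comment> \<open>The contact \<open>x Y\<close> has the neighbour \<open>d\<close> in
      \<open>D\<close>, which avoids the closed neighbourhood of \<open>Y\<close>. So
      \<open>x Y\<close> is outside \<open>Y\<close> but adjacent to it.\<close>
    then have xnY: "x Y \<notin> Y"
      using E_symD[OF d(2)] unfolding closed_nbhd_def by blast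
    have "x Y \<in> B"
      unfolding B_def using Y by blast
    with xY xnY have "E `` B \<inter> Y \<noteq> {}"
      using E_symD unfolding closed_nbhd_def by blast
    moreover have "y \<notin> Y" if "y \<in> B" for y
      using B_cases[OF that]
    proof
      assume "y \<in> D"
      then show ?thesis
        using Davoid[of Y] Y closed_nbhd_superset[of Y E] by blast
    next
      assume "\<exists>X\<in>Q. y = x X"
      then obtain X where X: "X \<in> Q" "y = x X"
        by blast
      show ?thesis
      proof (cases "X = Y")
        case False
        then have "x X \<notin> closed_nbhd E Y"
          using x[OF X(1)] Y by blast
        then show ?thesis
          using closed_nbhd_superset[of Y E] X(2) by blast
      qed (use xnY X(2) in simp)
    qed
    ultimately show ?thesis
      by blast
  qed
  have "card (insert B P) \<le> t"
    using assms(5) fin(1) by (simp add: card_insert_if)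
  moreover have "anticomplete (insert B P)"
    using model B_P closed_nbhd_commute[of B] unfolding biclique_model_def anticomplete_def
    by (metis insert_iff)
  ultimately have model': "biclique_model s t (insert B P) Q"
    using model \<open>B \<subseteq> V\<close> \<open>conn E B\<close> \<open>card B \<le> s\<close> B_Q
    unfolding biclique_model_def by (simp add: ball_Un)
  obtain D' where D': "heavy D'" "D' \<inter> blocked Z (insert B P \<union> Q) = {}"
      "E `` D' \<subseteq> D' \<union> blocked Z (insert B P \<union> Q)"
    by (rule exists_heavy_avoiding_blocked[OF nosep assms(2,3) model', of Z]) (use Z cZ in auto)
  have "blocked Z (insert B P \<union> Q) = blocked Z (P \<union> Q) \<union> closed_nbhd E B"
    unfolding blocked_def by (auto simp: closed_nbhd_Un)
  \<comment> \<open>Since \<open>v\<close> belongs to the new branch set, it is lost from the heavy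
    component, which therefore shrinks strictly.\<close>
  with D'(2) have "D' \<inter> blocked Z (P \<union> Q) = {}" and "v \<notin> D'"
    unfolding B_def closed_nbhd_def by auto
  then have "D' \<subset> D"
    using heavy_avoiding_subset[OF hD D'(1) ED] assms(6) by blast
  then have "card D' < card D"
    using finD by (simp add: psubset_card_mono)
  moreover from this have "state l s t D' Z (insert B P) Q"
    unfolding state_def using model' D' Z cZ by auto
  ultimately show ?thesis
    by blast
qed

text \<open>In a state of least measure a missing branch set can always be built: either the
  searches reach all of \<open>D\<close> and a branch set is added, or a sparse layer is split off.
  Both strictly shrink \<open>D\<close>, a contradiction.\<close>

lemma exists_full_biclique_model:
  assumes nosep: "\<nexists>S. coverable_separator k S"
    and "0 < l" "card V div l + 2 * t * s \<le> k"
    and m: "card V * card V < 2 ^ m" and s: "t * (l * m + 2) + 1 \<le> s"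
  shows "\<exists>P Q. biclique_model s t P Q \<and> card P = t \<and> card Q = t"
proof -
  \<comment> \<open>lexicographic order on \<open>(|D|, |P| + |Q|)\<close>, as \<open>|P| + |Q| \<le> 2t\<close>\<close>
  define \<mu> where "\<mu> = (\<lambda>(D :: 'a set, Z :: 'a set, P :: 'a set set, Q :: 'a set set).
    card D * (2 * t + 1) + card P + card Q)"
  have "biclique_model s t {} {}"
    unfolding biclique_model_def anticomplete_def by simp
  then obtain D0 where "heavy D0" "D0 \<inter> blocked {} ({} \<union> {}) = {}" "E `` D0 \<subseteq> D0 \<union> blocked {} ({} \<union> {})"
    by (rule exists_heavy_avoiding_blocked[OF nosep assms(2,3), of _ _ "{}"]) auto
  then have "state l s t D0 {} {} {}"
    unfolding state_def heavy_def using \<open>biclique_model s t {} {}\<close> card_mono[OF finite_V, of D0] by simp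
  then have "\<exists>y. (\<lambda>(D, Z, P, Q). state l s t D Z P Q) y"
    by auto
  from ex_has_least_nat[of "\<lambda>(D, Z, P, Q). state l s t D Z P Q" _ \<mu>] this
  obtain D Z P Q where st: "state l s t D Z P Q"
    and min: "\<And>D' Z' P' Q'. state l s t D' Z' P' Q' \<Longrightarrow> \<mu> (D, Z, P, Q) \<le> \<mu> (D', Z', P', Q')"
    by fastforce
  \<comment> \<open>The sides are generalized here so that the claim can also be applied with
    \<open>P\<close> and \<open>Q\<close> interchanged.\<close>
  have full: "card P = t" if st: "state l s t D Z P Q"
    and min: "\<And>D' Z' P' Q'. state l s t D' Z' P' Q' \<Longrightarrow> \<mu> (D, Z, P, Q) \<le> \<mu> (D', Z', P', Q')" for P Q
  proof (rule ccontr)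
    assume "card P \<noteq> t"
    then have P: "card P < t"
      using st unfolding state_def biclique_model_def by simp
    have hD: "heavy D"
      using st unfolding state_def by auto
    then have finD: "finite D" and cD: "conn E D" and DV: "D \<subseteq> V"
      using finite_V unfolding heavy_def by (auto intro: finite_subset)
    have nosmaller: False if "state l s t D' Z' P' Q'" "card D' < card D" for D' Z' P' Q'
    proof -
      have "card P' + card Q' \<le> 2 * t"
        using that(1) unfolding state_def biclique_model_def by simp
      moreover have "Suc (card D') * (2 * t + 1) \<le> card D * (2 * t + 1)"
        using that(2) by (intro mult_le_mono1) simp
      ultimately have "\<mu> (D', Z', P', Q') < \<mu> (D, Z, P, Q)"
        unfolding \<mu>_def by simp
      with min[OF that(1)] show False
        by simp
    qed
    define contact where "contact X d x \<longleftrightarrow> (d, x) \<in> E \<and> x \<in> closed_nbhd E X \<and>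
      (\<forall>Y \<in> P \<union> Q. Y \<noteq> X \<longrightarrow> x \<notin> closed_nbhd E Y)" for X d x
    define C where "C X = {d \<in> D. \<exists>x. contact X d x}" for X
    have C_sub: "C X \<subseteq> D" for X
      unfolding C_def by blast
    have C_ne: "C X \<noteq> {}" if X: "X \<in> Q" for X
    proof -
      have "X \<in> P \<union> Q"
        using X by simp
      moreover have "card D * (2 * t + 1) + card P + card Q \<le> card D' * (2 * t + 1) + card P' + card Q'"
        if "state l s t D' Z' P' Q'" for D' Z' P' Q'
        using min[OF that] unfolding \<mu>_def by (simp only: prod.case)
      ultimately obtain d x where "d \<in> D" "(d, x) \<in> E" "x \<in> closed_nbhd E X"
        "\<forall>Y \<in> P \<union> Q. Y \<noteq> X \<longrightarrow> x \<notin> closed_nbhd E Y"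
        by (rule private_contact[OF st])
      then show ?thesis
        unfolding C_def contact_def by blast
    qed
    have reach: "bfs_ball E D (C X) (l * m) = D" if X: "X \<in> Q" for X
    proof (rule ccontr)
      assume neq: "bfs_ball E D (C X) (l * m) \<noteq> D"
      have "card D * card D \<le> card V * card V"
        using card_mono[OF finite_V DV] by (intro mult_le_mono)
      then have "card D * card D < 2 ^ m"
        using m by simp
      then obtain j where j: "bfs_ball E D (C X) (Suc j) - bfs_ball E D (C X) j \<noteq> {}"
        "l * card (bfs_ball E D (C X) (Suc j) - bfs_ball E D (C X) j) \<le> card (bfs_ball E D (C X) j)"
        "l * card (bfs_ball E D (C X) (Suc j) - bfs_ball E D (C X) j) \<le> card (D - bfs_ball E D (C X) (Suc j))"
        using bfs_sparse_layer[OF finD cD C_sub C_ne[OF X] assms(2) _ neq] by metis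
      have sub: "bfs_ball E D (C X) j \<subseteq> bfs_ball E D (C X) (Suc j)"
        "bfs_ball E D (C X) (Suc j) \<subseteq> D" "E `` bfs_ball E D (C X) j \<inter> D \<subseteq> bfs_ball E D (C X) (Suc j)"
        using bfs_ball_subset[OF C_sub[of X], of E "Suc j"] by auto
      show False
        using split_off_layer[OF nosep assms(2,3) st sub(1,2) j(1) sub(3) j(2,3)] nosmaller by blast
    qed
    \<comment> \<open>Any vertex of \<open>D\<close> can be the common root, as each search covers
      all of \<open>D\<close>.\<close>
    obtain v where v: "v \<in> D"
      using conn_nonempty[OF cD] by blast
    have "\<exists>T. conn E T \<and> v \<in> T \<and> T \<subseteq> D \<and> T \<inter> C X \<noteq> {} \<and> finite T \<and> card T \<le> Suc (l * m)"
      if X: "X \<in> Q" for X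
      by (rule bfs_ball_tree[OF sym_E C_sub]) (use reach[OF X] v in simp)
    then obtain T where T: "\<And>X. X \<in> Q \<Longrightarrow> conn E (T X) \<and> v \<in> T X \<and> T X \<subseteq> D \<and> T X \<inter> C X \<noteq> {} \<and>
        card (T X) \<le> l * m + 1"
      unfolding Suc_eq_plus1 by metis
    have "\<exists>x. \<exists>d \<in> T X. contact X d x" if "X \<in> Q" for X
      using T[OF that] unfolding C_def by blast
    then obtain x where x: "\<And>X. X \<in> Q \<Longrightarrow> \<exists>d \<in> T X. contact X d (x X)"
      by metis
    have "\<exists>D' P'. state l s t D' Z P' Q \<and> card D' < card D"
    proof (rule add_branch_set[OF nosep assms(2,3) st P v s])
      show "conn E (T X) \<and> v \<in> T X \<and> T X \<subseteq> D \<and> card (T X) \<le> l * m + 1" if "X \<in> Q" for X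
        using T[OF that] by blast
      show "x X \<in> closed_nbhd E X \<and> (\<exists>d \<in> T X. (d, x X) \<in> E) \<and>
        (\<forall>Y \<in> P \<union> Q. Y \<noteq> X \<longrightarrow> x X \<notin> closed_nbhd E Y)" if "X \<in> Q" for X
        using x[OF that] unfolding contact_def by blast
    qed
    then show False
      using nosmaller by blast
  qed
  have "\<mu> (D, Z, Q, P) = \<mu> (D, Z, P, Q)"
    unfolding \<mu>_def by simp
  then have "card P = t" "card Q = t"
    using full[OF st] full[of Q P] st min state_commute by auto
  then show ?thesis
    using st unfolding state_def by blast
qed

end

section \<open>The separator theorem\<close>

lemma pair_graph_weighted_sym_graph:
  assumes "pair_graph G" "\<And>v. v \<in> pverts G \<Longrightarrow> 0 \<le> w v"
  shows "weighted_sym_graph (pverts G) (parcs G) w"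
proof -
  interpret pair_graph G by fact
  show ?thesis
    using assms(2) pair_finite_verts pair_sym_arcs in_arcsD1 in_arcsD2
    by unfold_locales (auto simp: symmetric_def)
qed

text \<open>Enumerating the two sides by \<open>f\<close> and \<open>g\<close> gives the branch map
  \<open>case_sum f g\<close>; anticompleteness yields the non-edges within a side.\<close>

lemma biclique_model_imp_induced_minor:
  assumes "pair_graph G" "weighted_sym_graph (pverts G) (parcs G) w"
    and "weighted_sym_graph.biclique_model (pverts G) (parcs G) s t P Q" "card P = t" "card Q = t"
  shows "induced_minor (complete_bipartite t t) G"
proof -
  interpret weighted_sym_graph "pverts G" "parcs G" w by fact
  have model: "finite P" "finite Q" "\<And>X. X \<in> P \<union> Q \<Longrightarrow> X \<subseteq> pverts G \<and> conn (parcs G) X"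
    "anticomplete P" "anticomplete Q"
    "\<And>X Y. X \<in> P \<Longrightarrow> Y \<in> Q \<Longrightarrow> X \<inter> Y = {} \<and> parcs G `` X \<inter> Y \<noteq> {}"
    using assms(3) unfolding biclique_model_def by auto
  obtain f where "bij_betw f {..<t} P"
    using ex_bij_betw_nat_finite[OF model(1)] assms(4) by (auto simp: lessThan_atLeast0)
  then have f: "\<And>i. i < t \<Longrightarrow> f i \<in> P" "\<And>i j. i < t \<Longrightarrow> j < t \<Longrightarrow> f i = f j \<Longrightarrow> i = j"
    by (auto simp: bij_betw_def inj_on_def)
  obtain g where "bij_betw g {..<t} Q"
    using ex_bij_betw_nat_finite[OF model(2)] assms(5) by (auto simp: lessThan_atLeast0)
  then have g: "\<And>i. i < t \<Longrightarrow> g i \<in> Q" "\<And>i j. i < t \<Longrightarrow> j < t \<Longrightarrow> g i = g j \<Longrightarrow> i = j"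
    by (auto simp: bij_betw_def inj_on_def)
  have same: "X \<inter> Y = {} \<and> parcs G `` X \<inter> Y = {}" if "anticomplete M" "X \<in> M" "Y \<in> M" "X \<noteq> Y" for M X Y
  proof -
    have "Y \<inter> closed_nbhd (parcs G) X = {}"
      using that unfolding anticomplete_def by metis
    then show ?thesis
      unfolding closed_nbhd_def by blast
  qed
  have fs: "f i \<inter> f j = {} \<and> parcs G `` f i \<inter> f j = {}" if "i < t" "j < t" "i \<noteq> j" for i j
    using same[OF model(4)] f that by metis
  have gs: "g i \<inter> g j = {} \<and> parcs G `` g i \<inter> g j = {}" if "i < t" "j < t" "i \<noteq> j" for i j
    using same[OF model(5)] g that by metis
  have cross: "f i \<inter> g j = {}" "g j \<inter> f i = {}" "parcs G `` f i \<inter> g j \<noteq> {}" "parcs G `` g j \<inter> f i \<noteq> {}"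
    if "i < t" "j < t" for i j
  proof -
    have fg: "f i \<inter> g j = {}" "parcs G `` f i \<inter> g j \<noteq> {}"
      using model(6) f(1) g(1) that by blast+
    then show "f i \<inter> g j = {}" "g j \<inter> f i = {}" "parcs G `` f i \<inter> g j \<noteq> {}"
      by blast+
    obtain x y where "x \<in> f i" "y \<in> g j" "(x, y) \<in> parcs G"
      using fg(2) by blast
    then show "parcs G `` g j \<inter> f i \<noteq> {}"
      using E_symD by blast
  qed
  show ?thesis
  proof (rule induced_minorI[OF assms(1), where B = "case_sum f g"])
    fix u assume "u \<in> pverts (complete_bipartite t t)"
    then have "case_sum f g u \<in> P \<union> Q"
      using f(1) g(1) by (auto simp: complete_bipartite_def Let_def)
    then show "case_sum f g u \<subseteq> pverts G \<and> conn (parcs G) (case_sum f g u)"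
      by (rule model(3))
  next
    fix u v assume uv: "u \<in> pverts (complete_bipartite t t)" "v \<in> pverts (complete_bipartite t t)" "u \<noteq> v"
    show "case_sum f g u \<inter> case_sum f g v = {}"
      using uv fs gs cross by (cases u; cases v) (simp_all add: complete_bipartite_def Let_def image_iff)
    show "(u, v) \<in> parcs (complete_bipartite t t) \<longleftrightarrow>
        parcs G `` case_sum f g u \<inter> case_sum f g v \<noteq> {}"
      using uv fs gs cross
      by (cases u; cases v) (simp_all add: complete_bipartite_def Let_def image_iff)
  qed
qed

lemma coverable_separator_imp:
  assumes "pair_graph G" "weighted_sym_graph (pverts G) (parcs G) w"
    and "weighted_sym_graph.coverable_separator (pverts G) (parcs G) w k S" "1 \<le> r"
  shows "balanced_separator G w S \<and> coverable G k r S"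
proof -
  interpret weighted_sym_graph "pverts G" "parcs G" w by fact
  obtain X where X: "X \<subseteq> pverts G" "card X \<le> k" "S \<subseteq> closed_nbhd (parcs G) X"
    and S: "S \<subseteq> pverts G" "\<And>D. heavy D \<Longrightarrow> D \<inter> S = {} \<Longrightarrow> \<not> parcs G `` D \<subseteq> D \<union> S"
    using assms(3) unfolding coverable_separator_def by auto
  have "balanced_separator G w S"
  proof (rule ccontr)
    assume "\<not> ?thesis"
    then obtain D where "conn (parcs G) D" "D \<subseteq> pverts G - S" "parcs G `` D \<subseteq> D \<union> S"
      "sum w (pverts G) / 2 < sum w D"
      using not_balanced_separatorE[OF assms(1) S(1)] by metis
    then show False
      using S(2)[of D] unfolding heavy_def by blast
  qed
  then show ?thesis
    using coverable_closed_nbhd[OF assms(1) X(1,2) assms(4) S(1) X(3)] by blast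
qed

text \<open>With \<open>l\<close> about \<surd>n and \<open>m\<close> about 2 log n (base 2), both
  \<open>n div l\<close> and \<open>l * m\<close> are of order at most \<surd>n log n.\<close>

lemma separator_parameters:
  fixes n t :: nat
  assumes "2 \<le> n"
  obtains l m where "0 < l" "n * n < 2 ^ m"
    "real (n div l + 2 * t * (t * (l * m + 2) + 1))
      \<le> (2 + 2 * real t * (16 * real t + 2)) * (sqrt (real n) * ln (real n))"
proof -
  define x where "x = sqrt (real n) * ln (real n)"
  define l where "l = nat \<lceil>sqrt (real n)\<rceil>"
  \<comment> \<open>The \<open>+ 1\<close> makes \<open>m\<close> strictly larger than the base 2
    logarithm of \<open>n * n\<close>.\<close>
  define m where "m = nat \<lfloor>2 * log 2 (real n)\<rfloor> + 1"
  have sqrt_ge: "1 \<le> sqrt (real n)"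
    using assms by simp
  \<comment> \<open>From ln(1/2) \<le> 1/2 - 1. This crude bound is enough to pass to natural
    logarithms and to absorb additive constants.\<close>
  have ln2_ge: "1 / 2 \<le> ln (2 :: real)"
    using ln_le_minus_one[of "1 / 2 :: real"] by (simp add: ln_div)
  moreover have "ln 2 \<le> ln (real n)"
    using assms by simp
  ultimately have ln_ge: "1 / 2 \<le> ln (real n)"
    by linarith
  have l_ge: "sqrt (real n) \<le> real l" and l_le: "real l \<le> 2 * sqrt (real n)" and "0 < l"
    unfolding l_def using sqrt_ge by linarith+
  have log_nonneg: "0 \<le> log 2 (real n)"
    using assms by simp
  have "2 * log 2 (real n) < real m"
    unfolding m_def using log_nonneg by linarith
  moreover have "log 2 (real n * real n) = 2 * log 2 (real n)"
    using assms by (subst log_mult) auto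
  ultimately have "log 2 (real n * real n) < real m"
    by simp
  then have "real n * real n < 2 powr real m"
    using assms by (subst (asm) log_less_iff) auto
  then have "real n * real n < 2 ^ m"
    by (simp add: powr_realpow)
  then have "real (n * n) < real (2 ^ m)"
    unfolding of_nat_mult of_nat_power of_nat_numeral .
  then have "n * n < 2 ^ m"
    by (rule of_nat_less_imp_less)
  have "real m \<le> 2 * log 2 (real n) + 1"
    unfolding m_def using log_nonneg by linarith
  moreover have "ln (real n) / ln 2 \<le> ln (real n) / (1 / 2)"
    using ln2_ge ln_ge by (intro divide_left_mono) auto
  then have "log 2 (real n) \<le> 2 * ln (real n)"
    unfolding log_def by simp
  ultimately have m_le: "real m \<le> 6 * ln (real n)"
    using ln_ge by linarith
  have "real (l * m) \<le> (2 * sqrt (real n)) * (6 * ln (real n))"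
    unfolding of_nat_mult using l_le m_le by (intro mult_mono) auto
  then have lm: "real (l * m) \<le> 12 * x"
    unfolding x_def by simp
  have "1 * (1 / 2) \<le> x"
    unfolding x_def using sqrt_ge ln_ge by (intro mult_mono) auto
  then have x: "1 \<le> 2 * x"
    by simp
  have "real (n div l) \<le> real n / real l"
    by (rule of_nat_div_le_of_nat)
  also have "\<dots> \<le> real n / sqrt (real n)"
    using l_ge sqrt_ge \<open>0 < l\<close> assms by (intro divide_left_mono mult_pos_pos) auto
  also have "\<dots> = sqrt (real n) * 1"
    by (simp add: real_div_sqrt)
  also have "\<dots> \<le> sqrt (real n) * (2 * ln (real n))"
    using ln_ge by (intro mult_left_mono) auto
  finally have div: "real (n div l) \<le> 2 * x"
    unfolding x_def by simp
  \<comment> \<open>As 1 \<le> \<open>2 * x\<close>, the summand 2 costs \<open>4 * x\<close> on top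
    of \<open>12 * x\<close>; the later summand 1 costs another \<open>2 * x\<close>.\<close>
  have "real t * (real (l * m) + 2) \<le> real t * (16 * x)"
    using lm x by (intro mult_left_mono) auto
  then have "real t * (real (l * m) + 2) + 1 \<le> (16 * real t + 2) * x"
    using x by (simp add: algebra_simps)
  then have "2 * real t * (real t * (real (l * m) + 2) + 1) \<le> 2 * real t * ((16 * real t + 2) * x)"
    by (intro mult_left_mono) auto
  then have "real (n div l + 2 * t * (t * (l * m + 2) + 1)) \<le> (2 + 2 * real t * (16 * real t + 2)) * x"
    using div by (simp add: algebra_simps)
  then show thesis
    using that \<open>0 < l\<close> \<open>n * n < 2 ^ m\<close> unfolding x_def by blast
qed

theorem theorem4:
  fixes t :: nat
  shows "\<exists>C :: real. \<forall>(G :: 'a pair_pre_digraph) (w :: 'a \<Rightarrow> real).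
    pair_graph G \<and> (\<forall>v\<in>pverts G. 0 \<le> w v) \<and> 2 \<le> card (pverts G) \<and>
    induced_minor_free (complete_bipartite t t) G \<longrightarrow>
    (\<exists>S k. balanced_separator G w S \<and> coverable G k 4 S \<and>
       real k \<le> C * (sqrt (real (card (pverts G))) * ln (real (card (pverts G)))))"
proof (intro exI[of _ "2 + 2 * real t * (16 * real t + 2)"] allI impI, elim conjE)
  fix G :: "'a pair_pre_digraph" and w :: "'a \<Rightarrow> real"
  assume G: "pair_graph G" and w: "\<forall>v\<in>pverts G. 0 \<le> w v" and n: "2 \<le> card (pverts G)"
    and free: "induced_minor_free (complete_bipartite t t) G"
  let ?n = "card (pverts G)"
  have graph: "weighted_sym_graph (pverts G) (parcs G) w"
    using pair_graph_weighted_sym_graph[OF G] w by blast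
  then interpret weighted_sym_graph "pverts G" "parcs G" w .
  obtain l m where lm: "0 < l" "?n * ?n < 2 ^ m"
    and bound: "real (?n div l + 2 * t * (t * (l * m + 2) + 1))
      \<le> (2 + 2 * real t * (16 * real t + 2)) * (sqrt (real ?n) * ln (real ?n))"
    using separator_parameters[OF n] by blast
  \<comment> \<open>\<open>s\<close> leaves room for a root and \<open>t\<close> trees with their
    contacts; \<open>k\<close> counts the centres from \<open>Z\<close> and from
    \<open>2 * t\<close> branch sets.\<close>
  define s k where "s = t * (l * m + 2) + 1" and "k = ?n div l + 2 * t * s"
  have "\<exists>S. coverable_separator k S"
  proof (rule ccontr)
    assume "\<nexists>S. coverable_separator k S"
    then obtain P Q where "biclique_model s t P Q" "card P = t" "card Q = t"
      using exists_full_biclique_model[of k l t s m] lm unfolding k_def s_def by blast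
    then show False
      using biclique_model_imp_induced_minor[OF G graph] free unfolding induced_minor_free_def by blast
  qed
  then obtain S where "coverable_separator k S"
    by blast
  then have "balanced_separator G w S \<and> coverable G k 4 S"
    by (rule coverable_separator_imp[OF G graph]) simp
  moreover have "real k \<le> (2 + 2 * real t * (16 * real t + 2)) * (sqrt (real ?n) * ln (real ?n))"
    using bound unfolding k_def s_def .
  ultimately show "\<exists>S k. balanced_separator G w S \<and> coverable G k 4 S \<and>
      real k \<le> (2 + 2 * real t * (16 * real t + 2)) * (sqrt (real ?n) * ln (real ?n))"
    by blast
qed

end
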